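(* Let $X$ be a unital Banach algebra over $K$ ($K=\mathbb{R}$ or $\mathbb{C}$), with a quasi-product $[\cdot,\cdot]_X$ and maps $g,\gamma:X\to X$ as fixed in the context. Let $F\in B(X)$ be generalized real definite with $F(0)=0$, and let $p$ be a polynomial with real coefficients. Suppose that the uniform spectral representation condition holds, i.e. the quasi-product either (a) is square bounded below and preserves the positivity, or (b) has a left integral domain. Then $p(F)$ has the spectral representation $$p(F)=\int_m^Mp(\lambda\gamma)\,d1_\lambda ,$$ where $[m,M]\subset\mathbb{R}$ is some bounded interval depending on $F$.
   Context: Spaces are nontrivial. $B(X)$ is the set of all (possibly nonlinear) maps $F:X\to X$ with $\|F\|_{B(X)}:=\max\left(\sup_{x\ne0}\|F(x)\|_X/\|x\|_X,\ \|F(0)\|_X\right)<\infty$. It is a unital Banach algebra under pointwise linear operations and the multiplication $(F_1*F_2)(x)=F_1(x)F_2(x)/\|x\|_X$ for $x\neq0$, $(F_1*F_2)(0)=F_1(0)F_2(0)$; its unit $e$ is $e(x)=\|x\|_X1$ for $x\ne0$, $e(0)=1$. For $p(\lambda)=\sum_{i=0}^na_i\lambda^i$ with real $a_i$ and $F\in B(X)$, $p(F)=\sum_{i=0}^na_iF^{*i}$, where $F^{*i}$ is the $i$-th power for $*$ and $F^{*0}=e$. A quasi-product on $X$ is a map $[\cdot,\cdot]_X:X\times X\to K$ such that: (a) $[x,x]_X\ge0$ for all $x$; (b) there is $\overline c>0$ with $|[x,y]_X|\le\overline c\|x\|_X\|y\|_X$ for all $x,y$; (c) there is a positive function $c:X\to\mathbb{R}$,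 bounded and bounded away from $0$, with $[\sum_{i=1}^n\alpha_ix_i,y]_X=c(y)\sum_{i=1}^n\alpha_i[x_i,y]_X$ for all $n\ge1$, $x_i,y\in X$, $\alpha_i\in K$. Fix a quasi-product $[\cdot,\cdot]_X$ and a map $g:X\to X$ with $g(x)\neq0$ for $x\ne0$. A map $F:X\to X$ is generalized real definite if $[F(x),g(x)]_X\in\mathbb{R}$ for all $x\in X$, and g-positive if $[F(x),g(x)]_X\ge0$ for all $x\in X$. Fix also a g-positive map $\gamma:X\to X$ with $[\gamma(x),g(x)]_X=k_1(x)\|x\|_X\|g(x)\|_X$ and $\|\gamma(x)\|_X=k_2(x)\|x\|_X$ for all $x$, where $k_1,k_2$ are positive bounded functions bounded away from $0$. The quasi-product: has a left integral domain if for $x,y\in X$ with $g(x)\ne0$, $[y,g(x)]_X=0$ implies $y=0$; preserves the positivity if for $x,y_1,y_2\in X$, $[y_1,g(x)]_X\ge0$ and $[y_2,g(x)]_X\ge0$ imply $[y_1y_2,g(x)]_X\ge0$; is square bounded below if there is $\underline k>0$ such that for $x,y\in X$, $[y^2,g(x)]_X\ge\underline k\|y\|_X^2\|g(x)\|_X$ whenever $y=1$ or $[y,g(x)]_X\in\mathbb{R}$. For generalized real definite $F$, $|F|(x)=F(x)$ if $[F(x),g(x)]_X\ge0$ and $|F|(x)=-F(x)$ otherwise; $F^+=(|F|+F)/2$. For $\lambda\in\mathbb{R}$, $F_\lambda=F-\lambda\gamma$, and $1_\lambda:X\to X$ is given by $1_\lambda(x)=1$ (the unit of $X$) if $F_\lambda^+(x)=0$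 and $1_\lambda(x)=0$ otherwise. For $f:\mathbb{R}\to\{\text{maps }X\to X\}$, partitions $m=s_0<s_1<\dots<s_n=M$ with $s_j-s_{j-1}<\epsilon_n$, $0<\epsilon_n\to0$, and $\lambda_j\in(s_{j-1},s_j]$, put $1_{\Delta_j}=1_{s_j}-1_{s_{j-1}}$. The operator $\int_m^Mf(\lambda)\,d1_\lambda$ denotes the limit in $\|\cdot\|_{B(X)}$, as $n\to\infty$, of $f(\lambda_1)1_{s_1}+\sum_{j=2}^nf(\lambda_j)1_{\Delta_j}$ (pointwise products in $X$), when it exists independently of the choice of the $\lambda_j$. *)

theory Defs
  imports "HOL-Analysis.Analysis" "HOL-Computational_Algebra.Polynomial"
begin

text \<open>
  The scalar field \<open>K\<close> is rendered by a type of class \<^class>\<open>real_normed_field\<close>.  By the theorem of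
  Gelfand and Mazur such a field, whose norm is multiplicative, is isometrically isomorphic to the
  reals or to the complex numbers, so that ranging over this class is ranging over these two cases.
  For \<open>z\<close> in \<open>K\<close>, ``\<open>z \<ge> 0\<close>'' means that \<open>z\<close> is real and nonnegative, i.e. \<open>z \<in> \<real>\<^sub>\<ge>\<^sub>0\<close>.
  The norm of the unit of \<open>X\<close> is not required to be 1.
\<close>

locale banach_algebra_over = vector_space smul
  for smul :: "'k::real_normed_field \<Rightarrow> 'a::{real_algebra_1, real_normed_algebra, banach} \<Rightarrow> 'a" +
  assumes smul_of_real: "smul (of_real r) x = r *\<^sub>R x"
    and norm_smul: "norm (smul \<alpha> x) = norm \<alpha> * norm x"
    and smul_mult_left: "smul \<alpha> x * y = smul \<alpha> (x * y)"
    and smul_mult_right: "x * smul \<alpha> y = smul \<alpha> (x * y)"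


subsection \<open>The algebra \<open>B(X)\<close> of nonlinear maps\<close>

definition BX :: "('a::{real_algebra_1, real_normed_algebra} \<Rightarrow> 'a) set" where
  "BX = {F. bdd_above ((\<lambda>x. norm (F x) / norm x) ` {x. x \<noteq> 0})}"

definition BX_norm :: "('a::{real_algebra_1, real_normed_algebra} \<Rightarrow> 'a) \<Rightarrow> real" where
  "BX_norm F = max (SUP x\<in>{x. x \<noteq> 0}. norm (F x) / norm x) (norm (F 0))"

definition BX_one :: "'a::{real_algebra_1, real_normed_algebra} \<Rightarrow> 'a" where
  "BX_one x = (if x = 0 then 1 else norm x *\<^sub>R 1)"

definition BX_mult ::
  "('a::{real_algebra_1, real_normed_algebra} \<Rightarrow> 'a) \<Rightarrow> ('a \<Rightarrow> 'a) \<Rightarrow> 'a \<Rightarrow> 'a" where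
  "BX_mult F G x = (if x = 0 then F 0 * G 0 else (F x * G x) /\<^sub>R norm x)"

primrec BX_power :: "('a::{real_algebra_1, real_normed_algebra} \<Rightarrow> 'a) \<Rightarrow> nat \<Rightarrow> 'a \<Rightarrow> 'a" where
  "BX_power F 0 = BX_one"
| "BX_power F (Suc n) = BX_mult F (BX_power F n)"

definition BX_poly ::
  "real poly \<Rightarrow> ('a::{real_algebra_1, real_normed_algebra} \<Rightarrow> 'a) \<Rightarrow> 'a \<Rightarrow> 'a" where
  "BX_poly p F x = (\<Sum>i\<le>degree p. coeff p i *\<^sub>R BX_power F i x)"


subsection \<open>Quasi-products\<close>

definition bounded_and_bounded_away_from_0 :: "('a \<Rightarrow> real) \<Rightarrow> bool" where
  "bounded_and_bounded_away_from_0 c \<longleftrightarrow> (\<exists>l u. l > 0 \<and> (\<forall>x. l \<le> c x \<and> c x \<le> u))"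

definition quasi_product ::
  "('k::real_normed_field \<Rightarrow> 'a::real_normed_vector \<Rightarrow> 'a) \<Rightarrow> ('a \<Rightarrow> 'a \<Rightarrow> 'k) \<Rightarrow> bool" where
  "quasi_product smul qp \<longleftrightarrow>
     (\<forall>x. qp x x \<in> \<real>\<^sub>\<ge>\<^sub>0) \<and>
     (\<exists>C>0. \<forall>x y. norm (qp x y) \<le> C * norm x * norm y) \<and>
     (\<exists>c. bounded_and_bounded_away_from_0 c \<and>
        (\<forall>n\<ge>1. \<forall>(\<alpha> :: nat \<Rightarrow> 'k) (xs :: nat \<Rightarrow> 'a) y.
           qp (\<Sum>i=1..n. smul (\<alpha> i) (xs i)) y
             = of_real (c y) * (\<Sum>i=1..n. \<alpha> i * qp (xs i) y)))"

definition generalized_real_definite ::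
  "('a \<Rightarrow> 'a \<Rightarrow> 'k::real_normed_field) \<Rightarrow> ('a \<Rightarrow> 'a) \<Rightarrow> ('a \<Rightarrow> 'a) \<Rightarrow> bool" where
  "generalized_real_definite qp g F \<longleftrightarrow> (\<forall>x. qp (F x) (g x) \<in> \<real>)"

definition g_positive ::
  "('a \<Rightarrow> 'a \<Rightarrow> 'k::real_normed_field) \<Rightarrow> ('a \<Rightarrow> 'a) \<Rightarrow> ('a \<Rightarrow> 'a) \<Rightarrow> bool" where
  "g_positive qp g F \<longleftrightarrow> (\<forall>x. qp (F x) (g x) \<in> \<real>\<^sub>\<ge>\<^sub>0)"

definition admissible_gamma ::
  "('a::real_normed_vector \<Rightarrow> 'a \<Rightarrow> 'k::real_normed_field) \<Rightarrow> ('a \<Rightarrow> 'a) \<Rightarrow> ('a \<Rightarrow> 'a) \<Rightarrow> bool" where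
  "admissible_gamma qp g \<gamma> \<longleftrightarrow>
     g_positive qp g \<gamma> \<and>
     (\<exists>k1 k2. bounded_and_bounded_away_from_0 k1 \<and> bounded_and_bounded_away_from_0 k2 \<and>
        (\<forall>x. qp (\<gamma> x) (g x) = of_real (k1 x * norm x * norm (g x))) \<and>
        (\<forall>x. norm (\<gamma> x) = k2 x * norm x))"

definition left_integral_domain ::
  "('a::real_normed_vector \<Rightarrow> 'a \<Rightarrow> 'k::real_normed_field) \<Rightarrow> ('a \<Rightarrow> 'a) \<Rightarrow> bool" where
  "left_integral_domain qp g \<longleftrightarrow> (\<forall>x y. g x \<noteq> 0 \<longrightarrow> qp y (g x) = 0 \<longrightarrow> y = 0)"

definition preserves_positivity ::
  "('a::real_normed_algebra \<Rightarrow> 'a \<Rightarrow> 'k::real_normed_field) \<Rightarrow> ('a \<Rightarrow> 'a) \<Rightarrow> bool" where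
  "preserves_positivity qp g \<longleftrightarrow>
     (\<forall>x y1 y2. qp y1 (g x) \<in> \<real>\<^sub>\<ge>\<^sub>0 \<longrightarrow> qp y2 (g x) \<in> \<real>\<^sub>\<ge>\<^sub>0 \<longrightarrow> qp (y1 * y2) (g x) \<in> \<real>\<^sub>\<ge>\<^sub>0)"

text \<open>An inequality \<open>z \<ge> r\<close> with \<open>z\<close> in \<open>K\<close> and \<open>r\<close> real is written \<open>z - of_real r \<in> \<real>\<^sub>\<ge>\<^sub>0\<close>.\<close>

definition square_bounded_below ::
  "('a::{real_algebra_1, real_normed_algebra} \<Rightarrow> 'a \<Rightarrow> 'k::real_normed_field) \<Rightarrow> ('a \<Rightarrow> 'a) \<Rightarrow> bool"
  where
  "square_bounded_below qp g \<longleftrightarrow>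
     (\<exists>k>0. \<forall>x y. y = 1 \<or> qp y (g x) \<in> \<real> \<longrightarrow>
        qp (y\<^sup>2) (g x) - of_real (k * (norm y)\<^sup>2 * norm (g x)) \<in> \<real>\<^sub>\<ge>\<^sub>0)"

definition uniform_spectral_representation_condition ::
  "('a::{real_algebra_1, real_normed_algebra} \<Rightarrow> 'a \<Rightarrow> 'k::real_normed_field) \<Rightarrow> ('a \<Rightarrow> 'a) \<Rightarrow> bool"
  where
  "uniform_spectral_representation_condition qp g \<longleftrightarrow>
     square_bounded_below qp g \<and> preserves_positivity qp g \<or> left_integral_domain qp g"


subsection \<open>The spectral family and the spectral integral\<close>

definition abs_map ::
  "('a::real_normed_vector \<Rightarrow> 'a \<Rightarrow> 'k::real_normed_field) \<Rightarrow> ('a \<Rightarrow> 'a) \<Rightarrow> ('a \<Rightarrow> 'a) \<Rightarrow> 'a \<Rightarrow> 'a"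
  where
  "abs_map qp g F x = (if qp (F x) (g x) \<in> \<real>\<^sub>\<ge>\<^sub>0 then F x else - F x)"

definition pos_part ::
  "('a::real_normed_vector \<Rightarrow> 'a \<Rightarrow> 'k::real_normed_field) \<Rightarrow> ('a \<Rightarrow> 'a) \<Rightarrow> ('a \<Rightarrow> 'a) \<Rightarrow> 'a \<Rightarrow> 'a"
  where
  "pos_part qp g F x = (abs_map qp g F x + F x) /\<^sub>R 2"

definition spectral_family ::
  "('a::{real_algebra_1, real_normed_algebra} \<Rightarrow> 'a \<Rightarrow> 'k::real_normed_field) \<Rightarrow> ('a \<Rightarrow> 'a)
     \<Rightarrow> ('a \<Rightarrow> 'a) \<Rightarrow> ('a \<Rightarrow> 'a) \<Rightarrow> real \<Rightarrow> 'a \<Rightarrow> 'a" where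
  "spectral_family qp g \<gamma> F r x =
     (if pos_part qp g (\<lambda>x. F x - r *\<^sub>R \<gamma> x) x = 0 then 1 else 0)"

definition spectral_sum ::
  "(real \<Rightarrow> 'a::real_normed_algebra \<Rightarrow> 'a) \<Rightarrow> (real \<Rightarrow> 'a \<Rightarrow> 'a)
     \<Rightarrow> nat \<Rightarrow> (nat \<Rightarrow> real) \<Rightarrow> (nat \<Rightarrow> real) \<Rightarrow> 'a \<Rightarrow> 'a" where
  "spectral_sum f E n s t x =
     f (t 1) x * E (s 1) x + (\<Sum>j=2..n. f (t j) x * (E (s j) x - E (s (j - 1)) x))"

text \<open>
  \<open>has_spectral_integral f E m M T\<close>: the integral of \<open>f\<close> with respect to the family \<open>E\<close> over \<open>[m, M]\<close>
  exists and equals \<open>T\<close>.  The \<open>n\<close>-th partition has the points \<open>s n 0, \<dots>, s n n\<close> and the tags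
  \<open>t n 1, \<dots>, t n n\<close>; convergence to \<open>T\<close> is required for all partitions and all tags.  Membership in
  \<^const>\<open>BX\<close> is stated since \<^const>\<open>BX_norm\<close> is meaningful only there.
\<close>

definition has_spectral_integral ::
  "(real \<Rightarrow> 'a::{real_algebra_1, real_normed_algebra} \<Rightarrow> 'a) \<Rightarrow> (real \<Rightarrow> 'a \<Rightarrow> 'a)
     \<Rightarrow> real \<Rightarrow> real \<Rightarrow> ('a \<Rightarrow> 'a) \<Rightarrow> bool" where
  "has_spectral_integral f E m M T \<longleftrightarrow>
     T \<in> BX \<and>
     (\<forall>(s :: nat \<Rightarrow> nat \<Rightarrow> real) (t :: nat \<Rightarrow> nat \<Rightarrow> real) (\<epsilon> :: nat \<Rightarrow> real).
        (\<forall>n\<ge>1. 0 < \<epsilon> n \<and> s n 0 = m \<and> s n n = M \<and>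
           (\<forall>j\<in>{1..n}. s n (j - 1) < s n j \<and> s n j - s n (j - 1) < \<epsilon> n \<and>
                        t n j \<in> {s n (j - 1)<..s n j})) \<longrightarrow>
        \<epsilon> \<longlonglongrightarrow> 0 \<longrightarrow>
        (\<forall>n\<ge>1. spectral_sum f E n (s n) (t n) \<in> BX) \<and>
        (\<lambda>n. BX_norm (\<lambda>x. spectral_sum f E n (s n) (t n) x - T x)) \<longlonglongrightarrow> 0)"

end

theory Submission
  imports Defs
begin

text \<open>
  The quasi-product is linear in its first argument, so the real number \<open>\<rho> x\<close> with
  \<open>[F x - \<rho> x \<gamma> x, g x] = 0\<close> exists for \<open>x \<noteq> 0\<close>, and \<open>\<rho>\<close> is bounded.  Either half of the uniform
  spectral representation condition forces a vector \<open>y\<close> with \<open>[y, g x] = 0\<close> to vanish; for (a), apply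
  preservation of positivity to \<open>y\<close> and \<open>-y\<close> to see that \<open>[y\<^sup>2, g x] \<le> 0\<close>.  Hence \<open>F = \<rho> \<gamma>\<close> pointwise
  and \<open>1\<^sub>\<lambda>\<close> is the indicator of \<open>\<rho> \<le> \<lambda>\<close>.  The spectral sum at \<open>x\<close> then collapses to
  \<open>p(\<lambda>\<^sub>j \<gamma>)(x)\<close>, where \<open>\<rho> x\<close> lies in the \<open>j\<close>-th interval, and \<open>r \<mapsto> p(r \<gamma>)\<close> is Lipschitz on bounded
  sets with respect to the norm of \<open>B(X)\<close>.
\<close>

section \<open>Linearity of the quasi-product and the vectors it annihilates\<close>

lemma quasi_product_linear:
  fixes smul :: "'k::real_normed_field \<Rightarrow> 'a::{real_algebra_1, real_normed_algebra, banach} \<Rightarrow> 'a"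
  assumes "banach_algebra_over smul" and "quasi_product smul qp"
  shows "qp (a *\<^sub>R u + b *\<^sub>R v) y = of_real a * qp u y + of_real b * qp v y"
proof -
  interpret banach_algebra_over smul by fact
  obtain c where c: "\<And>(\<alpha> :: nat \<Rightarrow> 'k) (xs :: nat \<Rightarrow> 'a) y n. n \<ge> 1 \<Longrightarrow>
      qp (\<Sum>i=1..n. smul (\<alpha> i) (xs i)) y = of_real (c y) * (\<Sum>i=1..n. \<alpha> i * qp (xs i) y)"
    using assms(2) unfolding quasi_product_def by blast
  \<comment> \<open>One-term sums give \<open>c y = 1\<close> unless \<open>[\<cdot>, y]\<close> vanishes identically.\<close>
  have one: "qp x y = of_real (c y) * qp x y" for x
    using c[of 1 "\<lambda>_. 1" "\<lambda>_. x" y] by simp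
  have "{1..2::nat} = {1, 2}" by auto
  then have "qp (a *\<^sub>R u + b *\<^sub>R v) y = of_real (c y) * (of_real a * qp u y + of_real b * qp v y)"
    using c[of 2 "\<lambda>i. if i = 1 then of_real a else of_real b" "\<lambda>i. if i = 1 then u else v" y]
    by (simp add: smul_of_real)
  \<comment> \<open>With \<open>c y\<close> moved onto each term, \<open>one\<close> absorbs it,
    whether or not the functional vanishes.\<close>
  also have "\<dots> = of_real a * (of_real (c y) * qp u y) + of_real b * (of_real (c y) * qp v y)"
    by (simp add: algebra_simps)
  finally show ?thesis by (simp flip: one)
qed

lemma uniform_condition_imp_eq_0:
  fixes smul :: "'k::real_normed_field \<Rightarrow> 'a::{real_algebra_1, real_normed_algebra, banach} \<Rightarrow> 'a"
  assumes "banach_algebra_over smul" and "quasi_product smul qp"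
    and "uniform_spectral_representation_condition qp g"
    and "g x \<noteq> 0" and "qp y (g x) = 0"
  shows "y = 0"
proof (cases "left_integral_domain qp g")
  case True
  with assms(4,5) show ?thesis unfolding left_integral_domain_def by blast
next
  case False
  with assms(3) have sq: "square_bounded_below qp g" and pos: "preserves_positivity qp g"
    unfolding uniform_spectral_representation_condition_def by auto
  have neg: "qp (- u) (g x) = - qp u (g x)" for u
    using quasi_product_linear[OF assms(1,2), of "-1" u 0 0 "g x"] by simp
  obtain k where k: "k > 0"
    "qp (y\<^sup>2) (g x) - of_real (k * (norm y)\<^sup>2 * norm (g x)) \<in> \<real>\<^sub>\<ge>\<^sub>0"
    using sq assms(5) unfolding square_bounded_below_def by (metis Reals_0)
  have "qp (- y) (g x) = 0" using neg[of y] assms(5) by simp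
  then have "qp (y * - y) (g x) \<in> \<real>\<^sub>\<ge>\<^sub>0"
    using pos assms(5) unfolding preserves_positivity_def by (metis nonneg_Reals_zero_I)
  then obtain b where b': "qp (y * - y) (g x) = of_real b" and "b \<ge> 0"
    by (rule nonneg_Reals_cases)
  have b: "qp (y\<^sup>2) (g x) = of_real (- b)"
    using neg[of "y * - y"] unfolding b' by (simp add: power2_eq_square)
  have "of_real (- b - k * (norm y)\<^sup>2 * norm (g x)) \<in> (\<real>\<^sub>\<ge>\<^sub>0 :: 'k set)"
    using k(2) unfolding b of_real_diff .
  \<comment> \<open>The square has value \<open>- b\<close>, so the lower bound for squares reads
    \<open>k * norm y ^ 2 * norm (g x)\<close> \<le> \<open>- b\<close> \<le> 0.\<close>
  then have "k * (norm y)\<^sup>2 * norm (g x) \<le> 0"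
    using \<open>b \<ge> 0\<close> by (simp only: nonneg_Reals_of_real_iff)
  then show ?thesis
    using k(1) assms(4) by (auto simp: mult_le_0_iff)
qed

section \<open>Powers and polynomials in the algebra of nonlinear maps\<close>

text \<open>A power at \<open>x\<close> depends on the map only through its value at
  \<open>x\<close>. The scalar may therefore vary with the point, which later allows
  \<open>r = \<rho> x\<close>.\<close>

lemma BX_power_scaleR:
  assumes "G x = r *\<^sub>R H x"
  shows "BX_power G i x = r ^ i *\<^sub>R BX_power H i x"
  by (induction i) (use assms in \<open>auto simp: BX_mult_def mult.commute\<close>)

lemma BX_poly_scaleR:
  assumes "G x = r *\<^sub>R H x"
  shows "BX_poly p G x = (\<Sum>i\<le>degree p. (coeff p i * r ^ i) *\<^sub>R BX_power H i x)"
  by (simp add: BX_poly_def BX_power_scaleR[of G x r H, OF assms])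

lemma BX_poly_scaleR_map:
  "BX_poly p (\<lambda>x. r *\<^sub>R H x) x = (\<Sum>i\<le>degree p. (coeff p i * r ^ i) *\<^sub>R BX_power H i x)"
  by (rule BX_poly_scaleR) simp

text \<open>Each multiplication divides by \<open>norm x\<close>, so the bound stays linear in
  \<open>norm x\<close>. The factor \<open>norm 1\<close> comes from the unit \<open>BX_one\<close>,
  since the unit of the algebra may have norm other than 1.\<close>

lemma norm_BX_power_le:
  fixes H :: "'a::{real_algebra_1, real_normed_algebra} \<Rightarrow> 'a"
  assumes "norm (H x) \<le> N * norm x" and "x \<noteq> 0"
  shows "norm (BX_power H i x) \<le> N ^ i * norm (1::'a) * norm x"
proof (induction i)
  case 0
  then show ?case using assms by (simp add: BX_one_def)
next
  case (Suc i)
  have "norm (BX_power H (Suc i) x) = norm (H x * BX_power H i x) / norm x"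
    using assms(2) by (simp add: BX_mult_def divide_inverse)
  also have "\<dots> \<le> (N * norm x) * (N ^ i * norm (1::'a) * norm x) / norm x"
    using assms Suc.IH
    by (intro divide_right_mono order_trans[OF norm_mult_ineq] mult_mono)
       (auto intro: order_trans[OF norm_ge_zero])
  finally show ?case using assms(2) by (simp add: algebra_simps)
qed

text \<open>The exponent \<open>i\<close> in place of the sharp \<open>i - 1\<close> avoids
  truncated subtraction; enlarging it is where 1 \<le> \<open>R\<close> enters.\<close>

lemma abs_power_diff_le:
  fixes r u :: real
  assumes "\<bar>r\<bar> \<le> R" "\<bar>u\<bar> \<le> R" "1 \<le> R"
  shows "\<bar>r ^ i - u ^ i\<bar> \<le> i * R ^ i * \<bar>r - u\<bar>"
proof (induction i)
  case (Suc i)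
  have "r ^ Suc i - u ^ Suc i = r * (r ^ i - u ^ i) + u ^ i * (r - u)"
    by (simp add: algebra_simps)
  then have "\<bar>r ^ Suc i - u ^ Suc i\<bar> \<le> \<bar>r\<bar> * \<bar>r ^ i - u ^ i\<bar> + \<bar>u\<bar> ^ i * \<bar>r - u\<bar>"
    by (metis abs_mult abs_triangle_ineq power_abs)
  also have "\<dots> \<le> R * (i * R ^ i * \<bar>r - u\<bar>) + R ^ Suc i * \<bar>r - u\<bar>"
  proof (intro add_mono mult_mono mult_right_mono)
    have "\<bar>u\<bar> ^ i \<le> R ^ i" using assms by (intro power_mono) auto
    also have "\<dots> \<le> R ^ Suc i" using assms by (intro power_increasing) auto
    finally show "\<bar>u\<bar> ^ i \<le> R ^ Suc i" .
  qed (use assms Suc.IH in auto)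
  finally show ?case by (simp add: algebra_simps)
qed simp

text \<open>One constant serves all \<open>x\<close>, so closeness of scalars, even of scalars that
  vary with the point, becomes closeness in the norm of B(X).\<close>

lemma BX_poly_Lipschitz:
  fixes H :: "'a::{real_algebra_1, real_normed_algebra} \<Rightarrow> 'a"
  assumes "\<And>x. norm (H x) \<le> N * norm x" and "1 \<le> R"
  obtains L where "0 \<le> L"
    and "\<And>r u x. \<bar>r\<bar> \<le> R \<Longrightarrow> \<bar>u\<bar> \<le> R \<Longrightarrow> x \<noteq> 0 \<Longrightarrow>
      norm (BX_poly p (\<lambda>x. r *\<^sub>R H x) x - BX_poly p (\<lambda>x. u *\<^sub>R H x) x) \<le> L * \<bar>r - u\<bar> * norm x"
proof
  define L where "L = (\<Sum>i\<le>degree p. \<bar>coeff p i\<bar> * (i * R ^ i) * (N ^ i * norm (1::'a)))"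
  \<comment> \<open>The growth bound at the nonzero point 1 forces \<open>N\<close> to be
    nonnegative.\<close>
  have "0 \<le> N * norm (1::'a)"
    by (rule order_trans[OF norm_ge_zero assms(1)])
  then have "0 \<le> N" by (simp add: zero_le_mult_iff)
  then show "0 \<le> L" unfolding L_def using assms(2) by (intro sum_nonneg) auto
  fix r u :: real and x :: 'a
  assume ru: "\<bar>r\<bar> \<le> R" "\<bar>u\<bar> \<le> R" and x: "x \<noteq> 0"
  have "BX_poly p (\<lambda>x. r *\<^sub>R H x) x - BX_poly p (\<lambda>x. u *\<^sub>R H x) x
      = (\<Sum>i\<le>degree p. (coeff p i * (r ^ i - u ^ i)) *\<^sub>R BX_power H i x)"
    by (simp add: BX_poly_scaleR_map sum_subtractf right_diff_distrib scaleR_left_diff_distrib)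
  also have "norm \<dots> \<le> (\<Sum>i\<le>degree p.
      (\<bar>coeff p i\<bar> * (i * R ^ i * \<bar>r - u\<bar>)) * (N ^ i * norm (1::'a) * norm x))"
  proof (rule order_trans[OF norm_sum], rule sum_mono, unfold norm_scaleR abs_mult)
    fix i
    show "\<bar>coeff p i\<bar> * \<bar>r ^ i - u ^ i\<bar> * norm (BX_power H i x)
        \<le> (\<bar>coeff p i\<bar> * (i * R ^ i * \<bar>r - u\<bar>)) * (N ^ i * norm (1::'a) * norm x)"
    proof (rule mult_mono)
      show "\<bar>coeff p i\<bar> * \<bar>r ^ i - u ^ i\<bar> \<le> \<bar>coeff p i\<bar> * (i * R ^ i * \<bar>r - u\<bar>)"
        by (rule mult_left_mono[OF abs_power_diff_le[OF ru assms(2)] abs_ge_zero])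
      show "norm (BX_power H i x) \<le> N ^ i * norm (1::'a) * norm x"
        by (rule norm_BX_power_le[of H x N, OF assms(1) x])
    qed (use assms(2) in simp_all)
  qed
  also have "\<dots> = L * \<bar>r - u\<bar> * norm x"
    unfolding L_def sum_distrib_right by (intro sum.cong) (simp_all add: mult_ac)
  finally show "norm (BX_poly p (\<lambda>x. r *\<^sub>R H x) x - BX_poly p (\<lambda>x. u *\<^sub>R H x) x)
      \<le> L * \<bar>r - u\<bar> * norm x" .
qed

section \<open>Membership and norm estimates in B(X)\<close>

lemma BX_I:
  assumes "\<And>x. x \<noteq> 0 \<Longrightarrow> norm (G x) \<le> C * norm x"
  shows "G \<in> BX"
  unfolding BX_def using assms by (auto intro!: bdd_aboveI[where M = C] simp: divide_le_eq)

lemma BX_E: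
  assumes "F \<in> BX"
  obtains C where "0 \<le> C" and "\<And>x. x \<noteq> 0 \<Longrightarrow> norm (F x) \<le> C * norm x"
proof -
  obtain C where C: "\<And>x. x \<noteq> 0 \<Longrightarrow> norm (F x) / norm x \<le> C"
    using assms unfolding BX_def bdd_above_def by auto
  show thesis
  proof
    show "0 \<le> C" using C[of 1] by (auto intro: order_trans[rotated])
    show "norm (F x) \<le> C * norm x" if "x \<noteq> 0" for x
      using C[OF that] that by (simp add: divide_le_eq)
  qed
qed

lemma BX_norm_le:
  fixes G :: "'a::{real_algebra_1, real_normed_algebra} \<Rightarrow> 'a"
  assumes "\<And>x. x \<noteq> 0 \<Longrightarrow> norm (G x) \<le> C * norm x" and "norm (G 0) \<le> C"
  shows "BX_norm G \<le> C"
proof -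
  have "{x::'a. x \<noteq> 0} \<noteq> {}" using one_neq_zero by blast
  then show ?thesis
    unfolding BX_norm_def using assms by (auto intro!: cSUP_least simp: divide_le_eq)
qed

lemma BX_norm_nonneg: "0 \<le> BX_norm G"
  unfolding BX_norm_def by (simp add: le_max_iff_disj)

section \<open>Partitions and the spectral sum at a point\<close>

text \<open>Along the partition the family at \<open>x\<close> jumps once, from 0 to 1, at index
  \<open>j\<close>, so only that increment survives. For \<open>j = 1\<close> the separate leading
  term takes the place of the increment.\<close>

lemma spectral_sum_collapse:
  fixes E :: "real \<Rightarrow> 'a::{real_algebra_1, real_normed_algebra} \<Rightarrow> 'a"
  assumes "j \<in> {1..n}" and "\<And>i. i \<in> {1..n} \<Longrightarrow> E (s i) x = (if j \<le> i then 1 else 0)"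
  shows "spectral_sum f E n s t x = f (t j) x"
proof -
  have "(\<Sum>i=2..n. f (t i) x * (E (s i) x - E (s (i - 1)) x)) =
    (\<Sum>i=2..n. if i = j then f (t j) x else 0)"
  proof (intro sum.cong refl)
    fix i assume i: "i \<in> {2..n}"
    then have "E (s i) x = (if j \<le> i then 1 else 0)" "E (s (i - 1)) x = (if j \<le> i - 1 then 1 else 0)"
      by (intro assms(2); auto)+
    with i show "f (t i) x * (E (s i) x - E (s (i - 1)) x) = (if i = j then f (t j) x else 0)"
      by (auto simp del: One_nat_def)
  qed
  moreover have "E (s 1) x = (if j = 1 then 1 else 0)"
    using assms by auto
  ultimately show ?thesis
    unfolding spectral_sum_def using assms(1) by (cases "j = 1") auto
qed

lemma partition_mono:
  fixes s :: "nat \<Rightarrow> real"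
  assumes "\<And>j. j \<in> {1..n} \<Longrightarrow> s (j - 1) < s j" and "i \<le> k" and "k \<le> n"
  shows "s i \<le> s k"
  using assms(2,3)
proof (induction k rule: dec_induct)
  case (step k)
  then show ?case using assms(1)[of "Suc k"] by auto
qed simp

text \<open>Take the least index whose point is at least \<open>r\<close>; strictness of
  \<open>s 0 < r\<close> keeps it from being 0.\<close>

lemma partition_locate:
  fixes s :: "nat \<Rightarrow> real"
  assumes "s 0 < r" and "r \<le> s n"
  obtains j where "j \<in> {1..n}" "s (j - 1) < r" "r \<le> s j"
proof
  define j where "j = (LEAST i. r \<le> s i)"
  show le: "r \<le> s j" unfolding j_def using assms(2) by (rule LeastI)
  have "j \<le> n" unfolding j_def using assms(2) by (rule Least_le)
  moreover have "j \<noteq> 0" using le assms(1) by (cases j) auto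
  ultimately show "j \<in> {1..n}" by auto
  have "j - 1 < j" using \<open>j \<noteq> 0\<close> by simp
  then show "s (j - 1) < r" unfolding j_def using not_less_Least by (metis not_le)
qed

section \<open>The map as a bounded multiple of \<gamma>, and its spectral family\<close>

lemma spectral_family_eq_indicator:
  fixes smul :: "'k::real_normed_field \<Rightarrow> 'a::{real_algebra_1, real_normed_algebra, banach} \<Rightarrow> 'a"
  assumes "banach_algebra_over smul" and "quasi_product smul qp"
    and "F x = \<rho> *\<^sub>R \<gamma> x" and "qp (\<gamma> x) (g x) = of_real a" and "0 < a"
  shows "spectral_family qp g \<gamma> F r x = (if \<rho> \<le> r then 1 else 0)"
proof -
  \<comment> \<open>Linearity with zero coefficients gives the zero vector the value 0, whereas
    \<gamma> \<open>x\<close> has the value \<open>a\<close> > 0.\<close>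
  have "\<gamma> x \<noteq> 0"
    using quasi_product_linear[OF assms(1,2), of 0 0 0 0 "g x"] assms(4,5) by auto
  have diff: "F x - r *\<^sub>R \<gamma> x = (\<rho> - r) *\<^sub>R \<gamma> x"
    by (simp add: assms(3) scaleR_left_diff_distrib)
  have "qp ((\<rho> - r) *\<^sub>R \<gamma> x) (g x) = of_real ((\<rho> - r) * a)"
    using quasi_product_linear[OF assms(1,2), of "\<rho> - r" "\<gamma> x" 0 0 "g x"] assms(4) by simp
  then have "qp ((\<rho> - r) *\<^sub>R \<gamma> x) (g x) \<in> \<real>\<^sub>\<ge>\<^sub>0 \<longleftrightarrow> r \<le> \<rho>"
    using assms(5) by (simp only: nonneg_Reals_of_real_iff) (simp add: zero_le_mult_iff)
  \<comment> \<open>At \<open>r = \<rho>\<close> both branches are 0, so the positive part vanishes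
    exactly for \<rho> \<le> \<open>r\<close>, endpoint included.\<close>
  then have "pos_part qp g (\<lambda>x. F x - r *\<^sub>R \<gamma> x) x = (if r \<le> \<rho> then (\<rho> - r) *\<^sub>R \<gamma> x else 0)"
    by (simp add: pos_part_def abs_map_def diff flip: scaleR_2)
  then show ?thesis using \<open>\<gamma> x \<noteq> 0\<close> by (simp add: spectral_family_def)
qed

text \<open>At the origin the family has no jump, so the leading term carries the whole spectral sum
  there.\<close>

lemma spectral_family_at_0:
  assumes "F 0 = 0" and "\<gamma> 0 = 0"
  shows "spectral_family qp g \<gamma> F r 0 = 1"
  using assms by (simp add: spectral_family_def pos_part_def abs_map_def)

lemma real_definite_eq_multiple:
  fixes smul :: "'k::real_normed_field \<Rightarrow> 'a::{real_algebra_1, real_normed_algebra, banach} \<Rightarrow> 'a"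
  assumes alg: "banach_algebra_over smul" and qp: "quasi_product smul qp"
    and g: "\<And>x. x \<noteq> 0 \<Longrightarrow> g x \<noteq> 0"
    and \<gamma>: "admissible_gamma qp g \<gamma>"
    and F: "F \<in> BX" "generalized_real_definite qp g F" "F 0 = 0"
    and cond: "uniform_spectral_representation_condition qp g"
  obtains \<rho> B where "0 \<le> B" and "\<And>x. \<bar>\<rho> x\<bar> \<le> B" and "\<And>x. F x = \<rho> x *\<^sub>R \<gamma> x"
    and "\<And>r x. x \<noteq> 0 \<Longrightarrow> spectral_family qp g \<gamma> F r x = (if \<rho> x \<le> r then 1 else 0)"
proof -
  obtain C where C: "0 \<le> C" "\<And>x. x \<noteq> 0 \<Longrightarrow> norm (F x) \<le> C * norm x"
    by (rule BX_E[OF F(1)]) (rule that)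
  obtain D where D: "0 < D" "\<And>x y. norm (qp x y) \<le> D * norm x * norm y"
    using qp unfolding quasi_product_def by blast
  obtain k1 l where k1: "0 < l" "\<And>x. l \<le> k1 x"
      "\<And>x. qp (\<gamma> x) (g x) = of_real (k1 x * norm x * norm (g x))"
    using \<gamma> unfolding admissible_gamma_def bounded_and_bounded_away_from_0_def by blast
  define a where "a x = k1 x * norm x * norm (g x)" for x
  have l_a: "l * norm x * norm (g x) \<le> a x" for x
    unfolding a_def using k1(2) by (intro mult_right_mono) auto
  have a: "0 < a x" if "x \<noteq> 0" for x
    using that g[OF that] k1(1) by (intro less_le_trans[OF _ l_a]) auto
  \<comment> \<open>The bound combines \<open>D\<close> for the quasi-product, \<open>C\<close> for
    \<open>F\<close> and the lower bound \<open>l\<close> of \<open>k1\<close>. For \<open>x\<close>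
    \<noteq> 0 the witness is the quotient of the values of \<open>F x\<close> and \<gamma>
    \<open>x\<close> against \<open>g x\<close>; at the origin it is 0.\<close>
  have ex: "\<exists>\<rho>. \<bar>\<rho>\<bar> \<le> D * C / l \<and> F x = \<rho> *\<^sub>R \<gamma> x" for x
  proof (cases "x = 0")
    case True
    then show ?thesis using C D k1(1) F(3) by (intro exI[of _ 0]) auto
  next
    case False
    obtain b where b: "qp (F x) (g x) = of_real b"
      using F(2) unfolding generalized_real_definite_def by (metis Reals_cases)
    have "\<bar>b\<bar> = norm (qp (F x) (g x))" by (simp add: b)
    also have "\<dots> \<le> D * (C * norm x) * norm (g x)"
      using C(2)[OF False] D by (intro order_trans[OF D(2)] mult_right_mono mult_left_mono) auto
    also have "\<dots> = D * C / l * (l * norm x * norm (g x))"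
      using k1(1) by simp
    also have "\<dots> \<le> D * C / l * a x"
      using C(1) D(1) k1(1) by (intro mult_left_mono l_a) auto
    finally have "\<bar>b / a x\<bar> \<le> D * C / l"
      using a[OF False] by (simp add: pos_divide_le_eq)
    moreover have "qp (F x - (b / a x) *\<^sub>R \<gamma> x) (g x) = of_real (b - b / a x * a x)"
      using quasi_product_linear[OF alg qp, of 1 "F x" "- (b / a x)" "\<gamma> x" "g x"]
      by (simp add: b k1(3) a_def)
    then have "qp (F x - (b / a x) *\<^sub>R \<gamma> x) (g x) = 0"
      using a[OF False] by simp
    then have "F x - (b / a x) *\<^sub>R \<gamma> x = 0"
      by (rule uniform_condition_imp_eq_0[OF alg qp cond g[OF False]])
    ultimately show ?thesis by (intro exI[of _ "b / a x"]) auto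
  qed
  then obtain \<rho> where \<rho>: "\<And>x. \<bar>\<rho> x\<bar> \<le> D * C / l" "\<And>x. F x = \<rho> x *\<^sub>R \<gamma> x"
    by metis
  show thesis
  proof (rule that[OF _ \<rho>])
    show "0 \<le> D * C / l" using C D k1(1) by auto
    show "spectral_family qp g \<gamma> F r x = (if \<rho> x \<le> r then 1 else 0)" if "x \<noteq> 0" for r x
      by (rule spectral_family_eq_indicator[OF alg qp, where a = "a x"])
         (use k1(3) a[OF that] \<rho>(2) in \<open>auto simp: a_def\<close>)
  qed
qed

section \<open>Convergence of the spectral sums\<close>

theorem theorem4p3:
  fixes smul :: "'k::real_normed_field \<Rightarrow> 'a::{real_algebra_1, real_normed_algebra, banach} \<Rightarrow> 'a"
    and qp :: "'a \<Rightarrow> 'a \<Rightarrow> 'k"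
    and g \<gamma> F :: "'a \<Rightarrow> 'a"
  assumes "banach_algebra_over smul"
    and "quasi_product smul qp"
    and "\<And>x. x \<noteq> 0 \<Longrightarrow> g x \<noteq> 0"
    and "admissible_gamma qp g \<gamma>"
    and "F \<in> BX"
    and "generalized_real_definite qp g F"
    and "F 0 = 0"
    and "uniform_spectral_representation_condition qp g"
  shows "\<exists>m M. m < M \<and>
    (\<forall>p :: real poly.
       has_spectral_integral (\<lambda>r. BX_poly p (\<lambda>x. r *\<^sub>R \<gamma> x))
         (spectral_family qp g \<gamma> F) m M (BX_poly p F))"
proof -
  obtain \<rho> B where B: "0 \<le> B" "\<And>x. \<bar>\<rho> x\<bar> \<le> B" and F: "\<And>x. F x = \<rho> x *\<^sub>R \<gamma> x"
    and E: "\<And>r x. x \<noteq> 0 \<Longrightarrow> spectral_family qp g \<gamma> F r x = (if \<rho> x \<le> r then 1 else 0)"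
    by (rule real_definite_eq_multiple[OF assms], assumption, rule that)
  obtain k2 N where k2: "\<And>x. k2 x \<le> N" "\<And>x. norm (\<gamma> x) = k2 x * norm x"
    using assms(4) unfolding admissible_gamma_def bounded_and_bounded_away_from_0_def by blast
  have N: "norm (\<gamma> x) \<le> N * norm x" for x
    using k2 by (simp add: mult_right_mono)
  have "\<gamma> 0 = 0" using k2(2)[of 0] by simp
  \<comment> \<open>The margin 1 puts every \<rho> \<open>x\<close> strictly above
    \<open>- R\<close>, as the left-open partition intervals require. It also gives 1 \<le>
    \<open>R\<close> for the Lipschitz bound, and the interval is the same for every
    \<open>p\<close>.\<close>
  define R where "R = B + 1"
  have R: "1 \<le> R" "\<bar>\<rho> x\<bar> < R" for x using B(1) B(2)[of x] by (auto simp: R_def)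
  let ?E = "spectral_family qp g \<gamma> F"
  have "has_spectral_integral (\<lambda>r. BX_poly p (\<lambda>x. r *\<^sub>R \<gamma> x)) ?E (- R) R (BX_poly p F)" for p
  proof -
    let ?f = "\<lambda>r. BX_poly p (\<lambda>x. r *\<^sub>R \<gamma> x)"
    let ?T = "BX_poly p F"
    obtain L where L: "0 \<le> L" "\<And>r u x. \<bar>r\<bar> \<le> R \<Longrightarrow> \<bar>u\<bar> \<le> R \<Longrightarrow> x \<noteq> 0 \<Longrightarrow>
        norm (?f r x - ?f u x) \<le> L * \<bar>r - u\<bar> * norm x"
      by (rule BX_poly_Lipschitz[of \<gamma> N R p, OF N R(1)]) (rule that)
    have T: "?T x = ?f (\<rho> x) x" for x
      by (rule trans[OF BX_poly_scaleR[of F x "\<rho> x" \<gamma>, OF F] BX_poly_scaleR_map[symmetric]])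
    \<comment> \<open>The norm of B(X) also measures the value at 0. There \<gamma> vanishes, so
      powers of positive degree are 0 and only the constant term remains.\<close>
    have f0: "?f r 0 = ?f u 0" for r u
    proof -
      have "BX_power (\<lambda>x. r *\<^sub>R \<gamma> x) i 0 = BX_power (\<lambda>x. u *\<^sub>R \<gamma> x) i 0" for i
        by (cases i) (auto simp: BX_mult_def \<open>\<gamma> 0 = 0\<close>)
      then show ?thesis by (simp add: BX_poly_def)
    qed
    have f: "?f r \<in> BX" if "\<bar>r\<bar> \<le> R" for r
    proof (rule BX_I)
      fix x :: 'a assume x: "x \<noteq> 0"
      have "norm (?f r x) \<le> (\<Sum>i\<le>degree p. \<bar>coeff p i * r ^ i\<bar> * (N ^ i * norm (1::'a) * norm x))"
        unfolding BX_poly_scaleR_map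
        by (rule order_trans[OF norm_sum], intro sum_mono, unfold norm_scaleR)
           (intro mult_left_mono norm_BX_power_le[of \<gamma> x N, OF N x] abs_ge_zero)
      also have "\<dots> = (\<Sum>i\<le>degree p. \<bar>coeff p i * r ^ i\<bar> * (N ^ i * norm (1::'a))) * norm x"
        by (simp add: sum_distrib_right mult.assoc)
      finally show "norm (?f r x) \<le> \<dots>" .
    qed
    obtain C where C: "\<And>x. x \<noteq> 0 \<Longrightarrow> norm (?f 0 x) \<le> C * norm x"
      by (rule BX_E[OF f[of 0]]) (use R(1) that in auto)
    \<comment> \<open>A growth bound uniform in the scalar is needed, since the scalar selected by
      \<rho> or by a tag changes with \<open>x\<close>.\<close>
    have fC: "norm (?f r x) \<le> (C + L * R) * norm x" if "\<bar>r\<bar> \<le> R" "x \<noteq> 0" for r x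
    proof -
      have "norm (?f r x) \<le> norm (?f 0 x) + norm (?f r x - ?f 0 x)"
        by norm
      also have "\<dots> \<le> C * norm x + L * \<bar>r\<bar> * norm x"
        using C[OF that(2)] L(2)[of r 0 x] that R(1) by (intro add_mono) auto
      also have "\<dots> \<le> C * norm x + L * R * norm x"
        using that L(1) by (intro add_left_mono mult_right_mono mult_left_mono) auto
      finally show ?thesis by (simp add: algebra_simps)
    qed
    have "?T \<in> BX"
    proof (rule BX_I)
      fix x :: 'a assume "x \<noteq> 0"
      then show "norm (?T x) \<le> (C + L * R) * norm x"
        unfolding T by (rule fC[OF less_imp_le[OF R(2)]])
    qed
    moreover have "(\<forall>n\<ge>1. spectral_sum ?f ?E n (s n) (t n) \<in> BX) \<and>
        (\<lambda>n. BX_norm (\<lambda>x. spectral_sum ?f ?E n (s n) (t n) x - ?T x)) \<longlonglongrightarrow> 0"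
      if part: "\<forall>n\<ge>1. 0 < \<epsilon> n \<and> s n 0 = - R \<and> s n n = R \<and>
           (\<forall>j\<in>{1..n}. s n (j - 1) < s n j \<and> s n j - s n (j - 1) < \<epsilon> n \<and>
                        t n j \<in> {s n (j - 1)<..s n j})" and \<epsilon>: "\<epsilon> \<longlonglongrightarrow> 0"
      for s t :: "nat \<Rightarrow> nat \<Rightarrow> real" and \<epsilon> :: "nat \<Rightarrow> real"
    proof -
      let ?S = "\<lambda>n. spectral_sum ?f ?E n (s n) (t n)"
      \<comment> \<open>The scalar is the tag of the subinterval containing \<rho> \<open>x\<close>;
        both lie in that subinterval, hence differ by less than the mesh bound.\<close>
      have S: "\<exists>r. \<bar>r\<bar> \<le> R \<and> \<bar>r - \<rho> x\<bar> < \<epsilon> n \<and> ?S n x = ?f r x" if n: "n \<ge> 1" and x: "x \<noteq> 0" for n x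
      proof -
        have mono: "s n i \<le> s n k" if "i \<le> k" "k \<le> n" for i k
          using part n that by (intro partition_mono[of n]) auto
        have "s n 0 < \<rho> x" "\<rho> x \<le> s n n"
          using part n R(2)[of x] by auto
        then obtain j where j: "j \<in> {1..n}" "s n (j - 1) < \<rho> x" "\<rho> x \<le> s n j"
          by (rule partition_locate)
        have "?E (s n i) x = (if j \<le> i then 1 else 0)" if "i \<in> {1..n}" for i
        proof (cases "j \<le> i")
          case True
          with that mono[of j i] j show ?thesis by (simp add: E[OF x])
        next
          case False
          then have "s n i \<le> s n (j - 1)" using j(1) by (intro mono) auto
          with j(2) False show ?thesis by (simp add: E[OF x])
        qed
        then have "?S n x = ?f (t n j) x" by (rule spectral_sum_collapse[OF j(1)])
        moreover have "- R \<le> s n (j - 1)" "s n j \<le> R"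
          using mono[of 0 "j - 1"] mono[of j n] j(1) part n by auto
        moreover have "s n (j - 1) < t n j" "t n j \<le> s n j" "s n j - s n (j - 1) < \<epsilon> n"
          using part n j(1) by auto
        ultimately show ?thesis using j by (intro exI[of _ "t n j"]) auto
      qed
      have S0: "?S n 0 = ?T 0" if "n \<ge> 1" for n
      proof -
        have "?S n 0 = ?f (t n 1) 0"
          by (rule spectral_sum_collapse[where j = 1])
             (use that in \<open>auto simp: spectral_family_at_0[of F \<gamma>, OF assms(7) \<open>\<gamma> 0 = 0\<close>]\<close>)
        also have "\<dots> = ?f (\<rho> 0) 0" by (rule f0)
        finally show ?thesis unfolding T .
      qed
      have "?S n \<in> BX" if "n \<ge> 1" for n
      proof (rule BX_I)
        fix x :: 'a assume x: "x \<noteq> 0"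
        obtain r where "\<bar>r\<bar> \<le> R" "?S n x = ?f r x" using S[OF \<open>n \<ge> 1\<close> x] by blast
        then show "norm (?S n x) \<le> (C + L * R) * norm x" by (simp only: fC[OF _ x])
      qed
      moreover have "BX_norm (\<lambda>x. ?S n x - ?T x) \<le> L * \<epsilon> n" if n: "n \<ge> 1" for n
      proof (rule BX_norm_le)
        show "norm (?S n 0 - ?T 0) \<le> L * \<epsilon> n"
        proof -
          have "0 < \<epsilon> n" using part n by blast
          then show ?thesis unfolding S0[OF n] using L(1) by simp
        qed
        fix x :: 'a assume x: "x \<noteq> 0"
        obtain r where r: "\<bar>r\<bar> \<le> R" "\<bar>r - \<rho> x\<bar> < \<epsilon> n" "?S n x = ?f r x"
          using S[OF n x] by blast
        have "norm (?S n x - ?T x) \<le> L * \<bar>r - \<rho> x\<bar> * norm x"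
          unfolding r(3) T using r R(2)[of x] x by (intro L(2)) auto
        also have "\<dots> \<le> L * \<epsilon> n * norm x"
          using r L(1) by (intro mult_right_mono mult_left_mono) auto
        finally show "norm (?S n x - ?T x) \<le> L * \<epsilon> n * norm x" .
      qed
      \<comment> \<open>Partitions are constrained only from index 1 on, so the estimate is stated
        eventually.\<close>
      then have "\<forall>\<^sub>F n in sequentially. norm (BX_norm (\<lambda>x. ?S n x - ?T x)) \<le> L * \<epsilon> n"
        unfolding real_norm_def abs_of_nonneg[OF BX_norm_nonneg]
        by (rule eventually_sequentiallyI[of 1])
      then have "(\<lambda>n. BX_norm (\<lambda>x. ?S n x - ?T x)) \<longlonglongrightarrow> 0"
        by (rule Lim_null_comparison[OF _ tendsto_mult_right_zero[OF \<epsilon>]])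
      ultimately show ?thesis by simp
    qed
    ultimately show ?thesis
      unfolding has_spectral_integral_def by (intro conjI[of "?T \<in> BX"] allI impI)
  qed
  then show ?thesis using R(1) by (intro exI[of _ "- R"] exI[of _ R]) auto
qed

end
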